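(* Let $(\Omega,\mathcal{F})$ be a measurable space, and assume that there exists a class $\mathcal{I}\subset\mathcal{F}$ such that $\sigma[\mathcal{I}]=\mathcal{F}$, $\emptyset\in\mathcal{I}$, $\Omega\in\mathcal{I}$, and $\mathcal{I}$ is totally ordered with respect to inclusion (for all $I_1,I_2\in\mathcal{I}$, either $I_1\subset I_2$ or $I_2\subset I_1$). Then for any submodular function $v:\mathcal{F}\to\mathbb{R}$ and for any $A,B\in\mathcal{F}$ satisfying $B\subset A$, there exists a unique $\mu\in\mathcal{C}_{-,v}(A)$ such that $$v(I)=\mu(I),\qquad I\in\mathcal{I}_{A,B}.$$ In particular, $v(B)=\mu(B)$ holds. Consequently, $$v(B)=\sup_{\mu\in\mathcal{C}_{-,v}(A)}\mu(B)$$ holds for all $A,B\in\mathcal{F}$ satisfying $B\subset A$.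
   Context: $\sigma[\mathcal{I}]$ denotes the smallest $\sigma$-algebra on $\Omega$ containing $\mathcal{I}$. A set function $v:\mathcal{F}\to\mathbb{R}$ is called submodular if all of the following hold: $v(\emptyset)=0$; $v$ is non-decreasing, i.e. $v(A)\le v(B)$ for all $A,B\in\mathcal{F}$ with $A\subset B$; $v$ is continuous, i.e. $\lim_{n\to\infty}v(A_n)=v(\bigcup_{n}A_n)$ for every increasing sequence $A_1\subset A_2\subset\cdots$ in $\mathcal{F}$ and $\lim_{n\to\infty}v(A_n)=v(\bigcap_{n}A_n)$ for every decreasing sequence $A_1\supset A_2\supset\cdots$ in $\mathcal{F}$; and $v(A)+v(B)\ge v(A\cup B)+v(A\cap B)$ for all $A,B\in\mathcal{F}$. For $A\in\mathcal{F}$, $\mathcal{F}|_A=\{B\in\mathcal{F}\mid B\subset A\}$, and $\mathcal{M}(A)$ is the set of finite ($\sigma$-additive, non-negative) measures on $(A,\mathcal{F}|_A)$. Define $$\mathcal{C}_{-,v}(A)=\{\mu\in\mathcal{M}(A)\mid \mu(A)=v(A),\ \mu(B)\le v(B)\text{ for all }B\in\mathcal{F}|_A\}.$$ For $\mathcal{I}\subset\mathcal{F}$ and $A,B\in\mathcal{F}$ with $B\subset A$, let $\mathcal{I}|_A=\{I\cap A\mid I\in\mathcal{I}\}$ and $$\mathcal{I}_{A,B}=\{B\cap I\mid I\in\mathcal{I}|_A\}\cup\{B\cup I\mid I\in\mathcal{I}|_A\}.$$ *)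

theory Defs
  imports "HOL-Analysis.Analysis"
begin

text \<open>
  A set function on a family \<open>F\<close> is a total function \<open>'a set \<Rightarrow> real\<close>; only its values on
  \<open>F\<close> matter. Following the source, submodularity includes normalisation, monotonicity and
  sequential continuity from below and from above.
\<close>

definition submodular :: "'a set set \<Rightarrow> ('a set \<Rightarrow> real) \<Rightarrow> bool" where
  "submodular F v \<longleftrightarrow>
     v {} = 0 \<and>
     (\<forall>A\<in>F. \<forall>B\<in>F. A \<subseteq> B \<longrightarrow> v A \<le> v B) \<and>
     (\<forall>X :: nat \<Rightarrow> 'a set. range X \<subseteq> F \<longrightarrow> incseq X \<longrightarrow> (\<lambda>n. v (X n)) \<longlonglongrightarrow> v (\<Union>n. X n)) \<and>
     (\<forall>X :: nat \<Rightarrow> 'a set. range X \<subseteq> F \<longrightarrow> decseq X \<longrightarrow> (\<lambda>n. v (X n)) \<longlonglongrightarrow> v (\<Inter>n. X n)) \<and>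
     (\<forall>A\<in>F. \<forall>B\<in>F. v A + v B \<ge> v (A \<union> B) + v (A \<inter> B))"

definition sub_sigma :: "'a set set \<Rightarrow> 'a set \<Rightarrow> 'a set set" where
  "sub_sigma F A = {B \<in> F. B \<subseteq> A}"

text \<open>
  A value of type \<open>'a measure\<close> is determined by its space, its measurable sets and its values
  on these, so equality in \<open>finite_measures_on F A\<close> is equality of measures on \<open>sub_sigma F A\<close>.
\<close>

definition finite_measures_on :: "'a set set \<Rightarrow> 'a set \<Rightarrow> 'a measure set" where
  "finite_measures_on F A =
     {\<mu>. space \<mu> = A \<and> sets \<mu> = sub_sigma F A \<and> finite_measure \<mu>}"

definition core_minus :: "'a set set \<Rightarrow> ('a set \<Rightarrow> real) \<Rightarrow> 'a set \<Rightarrow> 'a measure set" where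
  "core_minus F v A =
     {\<mu> \<in> finite_measures_on F A.
        measure \<mu> A = v A \<and> (\<forall>B \<in> sub_sigma F A. measure \<mu> B \<le> v B)}"

definition trace_class :: "'a set set \<Rightarrow> 'a set \<Rightarrow> 'a set set" where
  "trace_class \<I> A = {J \<inter> A | J. J \<in> \<I>}"

definition refined_class :: "'a set set \<Rightarrow> 'a set \<Rightarrow> 'a set \<Rightarrow> 'a set set" where
  "refined_class \<I> A B =
     {B \<inter> J | J. J \<in> trace_class \<I> A} \<union> {B \<union> J | J. J \<in> trace_class \<I> A}"

end

theory Submission
  imports Defs
begin

text \<open>
  The refined class \<open>C\<close> is again totally ordered by inclusion, it contains \<open>{}\<close>, \<open>B\<close> and \<open>A\<close>,
  and it generates the trace \<open>\<sigma>\<close>-algebra on \<open>A\<close>, since \<open>J = (B \<inter> J) \<union> ((B \<union> J) - B)\<close> recovers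
  every trace. A chain is stable under intersection, so a finite measure is determined by its
  values on \<open>C\<close>; this is uniqueness. What remains is to find a measure that agrees with \<open>v\<close> on a
  generating chain and lies below \<open>v\<close> everywhere.
  
  Read \<open>v\<close> as a clock along the chain: the step from \<open>I\<close> to \<open>J\<close> takes the time interval
  \<open>{v I..<v J}\<close>. Let \<open>levels E\<close> be the set of times that belong to a step \<open>J - I\<close> inside \<open>E\<close>, and let
  the measure of \<open>E\<close> be the Lebesgue measure of \<open>levels E\<close>. As two steps at a common time always
  overlap, disjoint sets have disjoint levels. Hence no choice of a representation of \<open>E\<close> by
  steps is involved, and on the algebra of sets cut out by finitely many members of \<open>C\<close> the
  operation \<open>levels\<close> respects unions and complements, which gives finite additivity
  (\<open>algebra_step_sets\<close>, \<open>levels_Un\<close>).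
  
  Submodularity enters in \<open>measure_levels_le\<close>: when the chain passes from \<open>I\<close> to \<open>J\<close> inside \<open>E\<close>,
  the value \<open>v (E \<inter> _)\<close> grows by at least \<open>v J - v I\<close>, and when it passes outside \<open>E\<close> nothing
  changes. So the measure lies below \<open>v\<close> on the algebra. This bound, with the continuity of \<open>v\<close> at
  \<open>{}\<close>, makes the additive function continuous at \<open>{}\<close>, hence it extends to a measure by
  Caratheodory's theorem. Both sides of the bound are continuous along monotone sequences, so the
  bound passes to the generated \<open>\<sigma>\<close>-algebra by the monotone class theorem. The formula for
  \<open>v B\<close> follows because \<open>B\<close> itself is a member of the chain.
\<close>

section \<open>Monotone classes\<close>

inductive_set monotone_class :: "'a set set \<Rightarrow> 'a set set" for M where
  base: "E \<in> M \<Longrightarrow> E \<in> monotone_class M"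
| up: "(\<And>n. X n \<in> monotone_class M) \<Longrightarrow> incseq X \<Longrightarrow> (\<Union>n::nat. X n) \<in> monotone_class M"
| down: "(\<And>n. X n \<in> monotone_class M) \<Longrightarrow> decseq X \<Longrightarrow> (\<Inter>n::nat. X n) \<in> monotone_class M"

text \<open>
  An algebra that is closed under monotone limits is a \<open>\<sigma>\<close>-algebra, so it suffices to see that the
  monotone class inherits the operations of the algebra. Intersections need two inductions: first
  one factor is kept in the algebra, then that factor is released.
\<close>

lemma (in algebra) monotone_class_eq_sigma_sets: "monotone_class M = sigma_sets \<Omega> M"
proof
  show mono: "monotone_class M \<subseteq> sigma_sets \<Omega> M"
  proof
    fix E assume "E \<in> monotone_class M"
    then show "E \<in> sigma_sets \<Omega> M"
    proof induction
      case (down X)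
      interpret S: sigma_algebra \<Omega> "sigma_sets \<Omega> M"
        by (rule sigma_algebra_sigma_sets) (rule space_closed)
      show ?case using down.IH by (intro S.countable_INT) auto
    qed (auto intro: sigma_sets.Basic sigma_sets.Union)
  qed
  have incseq_Int: "incseq (\<lambda>n. a \<inter> X n)" if "incseq X" for a and X :: "nat \<Rightarrow> 'a set"
    using that unfolding incseq_def by blast
  have decseq_Int: "decseq (\<lambda>n. a \<inter> X n)" if "decseq X" for a and X :: "nat \<Rightarrow> 'a set"
    using that unfolding decseq_def by blast
  have inter_base: "a \<inter> b \<in> monotone_class M" if "b \<in> monotone_class M" "a \<in> M" for a b
    using that
  proof induction
    case (base E)
    then show ?case by (auto intro: monotone_class.base)
  next
    case (up X)
    have "(\<Union>n. a \<inter> X n) \<in> monotone_class M"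
      by (intro monotone_class.up incseq_Int) (use up in \<open>simp_all add: Int_commute\<close>)
    then show ?case by simp
  next
    case (down X)
    have "(\<Inter>n. a \<inter> X n) \<in> monotone_class M"
      by (intro monotone_class.down decseq_Int) (use down in \<open>simp_all add: Int_commute\<close>)
    then show ?case by simp
  qed
  have inter: "a \<inter> b \<in> monotone_class M" if "a \<in> monotone_class M" "b \<in> monotone_class M" for a b
    using that
  proof induction
    case (base E)
    then show ?case by (auto intro: inter_base)
  next
    case (up X)
    have "(\<Union>n. b \<inter> X n) \<in> monotone_class M"
      by (intro monotone_class.up incseq_Int) (use up in \<open>simp_all add: Int_commute\<close>)
    then show ?case by (simp add: Int_commute)
  next
    case (down X)
    have "(\<Inter>n. b \<inter> X n) \<in> monotone_class M"
      by (intro monotone_class.down decseq_Int) (use down in \<open>simp_all add: Int_commute\<close>)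
    then show ?case by (simp add: Int_commute)
  qed
  have compl: "\<Omega> - a \<in> monotone_class M" if "a \<in> monotone_class M" for a
    using that
  proof induction
    case (base E)
    then show ?case by (auto intro: monotone_class.base)
  next
    case (up X)
    have "(\<Inter>n. \<Omega> - X n) \<in> monotone_class M"
      by (rule monotone_class.down) (use up in \<open>simp_all add: incseq_def decseq_def Diff_mono\<close>)
    then show ?case by simp
  next
    case (down X)
    have "(\<Union>n. \<Omega> - X n) \<in> monotone_class M"
      by (rule monotone_class.up) (use down in \<open>simp_all add: incseq_def decseq_def Diff_mono\<close>)
    then show ?case by simp
  qed
  have sub: "a \<subseteq> \<Omega>" if "a \<in> monotone_class M" for a
    using that mono sigma_sets_into_sp[OF space_closed] by blast
  have union: "a \<union> b \<in> monotone_class M"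
    if "a \<in> monotone_class M" "b \<in> monotone_class M" for a b
  proof -
    have "a \<union> b = \<Omega> - (\<Omega> - a) \<inter> (\<Omega> - b)" using sub that by blast
    then show ?thesis using compl inter that by simp
  qed
  show "sigma_sets \<Omega> M \<subseteq> monotone_class M"
  proof
    fix E assume "E \<in> sigma_sets \<Omega> M"
    then show "E \<in> monotone_class M"
    proof induction
      case (Union X)
      have "(\<Union>i\<le>n. X i) \<in> monotone_class M" for n :: nat
        by (induction n) (use Union.IH union in \<open>auto simp: atMost_Suc\<close>)
      moreover have "incseq (\<lambda>n. \<Union>i\<le>n. X i)"
        unfolding incseq_def by force
      ultimately have "(\<Union>n. \<Union>i\<le>n. X i) \<in> monotone_class M"
        by (rule monotone_class.up)
      moreover have "(\<Union>n. \<Union>i\<le>n. X i) = (\<Union>n. X n)" by auto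
      ultimately show ?case by simp
    qed (auto intro: monotone_class.base compl)
  qed
qed

section \<open>Submodular functions on a generating chain\<close>

lemma submodular_subset:
  assumes "submodular F v" "M \<subseteq> F"
  shows "submodular M v"
  using assms unfolding submodular_def by (meson subset_eq subset_trans)

locale submodular_chain = sigma_algebra A M for A :: "'a set" and M +
  fixes C :: "'a set set" and v :: "'a set \<Rightarrow> real"
  assumes submodular: "submodular M v"
    and chain: "\<And>I J. I \<in> C \<Longrightarrow> J \<in> C \<Longrightarrow> I \<subseteq> J \<or> J \<subseteq> I"
    and generates: "sigma_sets A C = M"
    and empty_in_chain: "{} \<in> C"
    and space_in_chain: "A \<in> C"
begin

lemma chain_sets: "J \<in> C \<Longrightarrow> J \<in> M"
  using generates by (auto intro: sigma_sets.Basic)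

lemma chain_Int: "I \<in> C \<Longrightarrow> J \<in> C \<Longrightarrow> I \<inter> J \<in> C"
  using chain[of I J] by (auto simp: Int_absorb1 Int_absorb2)

lemma chain_Un: "I \<in> C \<Longrightarrow> J \<in> C \<Longrightarrow> I \<union> J \<in> C"
  using chain[of I J] by (auto simp: Un_absorb1 Un_absorb2)

lemma v_empty: "v {} = 0"
  and v_mono: "\<lbrakk>D \<in> M; E \<in> M; D \<subseteq> E\<rbrakk> \<Longrightarrow> v D \<le> v E"
  and v_up: "\<lbrakk>range X \<subseteq> M; incseq X\<rbrakk> \<Longrightarrow> (\<lambda>n. v (X n)) \<longlonglongrightarrow> v (\<Union>n::nat. X n)"
  and v_down: "\<lbrakk>range X \<subseteq> M; decseq X\<rbrakk> \<Longrightarrow> (\<lambda>n. v (X n)) \<longlonglongrightarrow> v (\<Inter>n::nat. X n)"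
  and v_submod: "\<lbrakk>D \<in> M; E \<in> M\<rbrakk> \<Longrightarrow> v (D \<union> E) + v (D \<inter> E) \<le> v D + v E"
  using submodular unfolding submodular_def by blast+

lemma v_nonneg: "E \<in> M \<Longrightarrow> 0 \<le> v E"
  using v_mono[of "{}" E] v_empty by simp

subsection \<open>The levels at which the chain runs inside a set\<close>

text \<open>
  The intervals are half-open to match the differences \<open>J - I\<close>: consecutive steps of the
  chain have disjoint, adjacent intervals. A step on which \<open>v\<close> is constant contributes nothing.
\<close>

definition levels :: "'a set \<Rightarrow> real set" where
  "levels E = {r. \<exists>I\<in>C. \<exists>J\<in>C. v I \<le> r \<and> r < v J \<and> J - I \<subseteq> E}"

lemma levelsI: "\<lbrakk>I \<in> C; J \<in> C; v I \<le> r; r < v J; J - I \<subseteq> E\<rbrakk> \<Longrightarrow> r \<in> levels E"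
  unfolding levels_def by blast

lemma levels_mono: "D \<subseteq> E \<Longrightarrow> levels D \<subseteq> levels E"
  unfolding levels_def by blast

lemma levels_empty: "levels {} = {}"
proof -
  have False if "I \<in> C" "J \<in> C" "v I \<le> r" "r < v J" "J \<subseteq> I" for I J and r :: real
    using v_mono[of J I] that by (auto simp: chain_sets)
  then show ?thesis unfolding levels_def by auto
qed

text \<open>
  If two steps \<open>J - I\<close> and \<open>J' - I'\<close> share a time, then so does the step from the larger of
  \<open>I\<close>, \<open>I'\<close> to the smaller of \<open>J\<close>, \<open>J'\<close>, and it lies in both.
\<close>

lemma levels_Int: "levels (D \<inter> E) = levels D \<inter> levels E"
proof
  show "levels (D \<inter> E) \<subseteq> levels D \<inter> levels E"
    by (simp add: levels_mono)
  show "levels D \<inter> levels E \<subseteq> levels (D \<inter> E)"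
  proof
    fix r assume "r \<in> levels D \<inter> levels E"
    then obtain I J I' J' where *: "I \<in> C" "J \<in> C" "v I \<le> r" "r < v J" "J - I \<subseteq> D"
      "I' \<in> C" "J' \<in> C" "v I' \<le> r" "r < v J'" "J' - I' \<subseteq> E"
      unfolding levels_def by blast
    show "r \<in> levels (D \<inter> E)"
    proof (rule levelsI)
      show "v (I \<union> I') \<le> r"
        using chain[of I I'] * by (auto simp: Un_absorb1 Un_absorb2)
      show "r < v (J \<inter> J')"
        using chain[of J J'] * by (auto simp: Int_absorb1 Int_absorb2)
    qed (use * in \<open>auto intro: chain_Int chain_Un\<close>)
  qed
qed

lemma levels_disjoint: "D \<inter> E = {} \<Longrightarrow> levels D \<inter> levels E = {}"
  by (metis levels_Int levels_empty)

lemma levels_chain: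
  assumes "J \<in> C"
  shows "levels J = {0..<v J}"
proof
  show "levels J \<subseteq> {0..<v J}"
  proof
    fix r assume "r \<in> levels J"
    then obtain I K where *: "I \<in> C" "K \<in> C" "v I \<le> r" "r < v K" "K - I \<subseteq> J"
      unfolding levels_def by blast
    have "r < v J"
    proof (rule ccontr)
      assume "\<not> r < v J"
      then have "r \<in> levels (K - J)" using * assms by (auto intro: levelsI)
      moreover have "r \<in> levels (K - I)" using * by (auto intro: levelsI)
      ultimately have "r \<in> levels ((K - J) \<inter> (K - I))" by (simp add: levels_Int)
      moreover have "(K - J) \<inter> (K - I) = {}" using * by blast
      ultimately show False by (simp add: levels_empty)
    qed
    then show "r \<in> {0..<v J}" using v_nonneg[OF chain_sets] * by fastforce
  qed
  show "{0..<v J} \<subseteq> levels J"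
    using assms empty_in_chain by (auto simp: v_empty intro: levelsI)
qed

lemma levels_subset: "E \<subseteq> A \<Longrightarrow> levels E \<subseteq> {0..<v A}"
  using levels_mono[of E A] levels_chain[OF space_in_chain] by simp

subsection \<open>Sets cut out by finitely many members of the chain\<close>

text \<open>
  The members of \<open>T\<close> divide \<open>A\<close> into atoms; the set \<open>E\<close> has to be a union of such atoms.
\<close>

definition saturated :: "'a set set \<Rightarrow> 'a set \<Rightarrow> bool" where
  "saturated T E \<longleftrightarrow> (\<forall>x\<in>A. \<forall>y\<in>A. (\<forall>I\<in>T. x \<in> I \<longleftrightarrow> y \<in> I) \<longrightarrow> (x \<in> E \<longleftrightarrow> y \<in> E))"

lemma saturatedD:
  "\<lbrakk>saturated T E; x \<in> A; y \<in> A; \<And>I. I \<in> T \<Longrightarrow> x \<in> I \<longleftrightarrow> y \<in> I\<rbrakk> \<Longrightarrow> x \<in> E \<longleftrightarrow> y \<in> E"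
  unfolding saturated_def by blast

lemma saturated_mono:
  assumes "saturated S E" "S \<subseteq> T"
  shows "saturated T E"
  unfolding saturated_def
proof (intro ballI impI)
  fix x y assume xy: "x \<in> A" "y \<in> A" "\<forall>I\<in>T. x \<in> I \<longleftrightarrow> y \<in> I"
  show "x \<in> E \<longleftrightarrow> y \<in> E" by (rule saturatedD[OF assms(1) xy(1,2) bspec[OF xy(3)]]) (use assms(2) in blast)
qed

lemma saturated_Int:
  assumes "saturated T D" "saturated T E"
  shows "saturated T (D \<inter> E)"
  unfolding saturated_def
proof (intro ballI impI)
  fix x y assume xy: "x \<in> A" "y \<in> A" "\<forall>I\<in>T. x \<in> I \<longleftrightarrow> y \<in> I"
  have "x \<in> D \<longleftrightarrow> y \<in> D" using saturatedD[OF assms(1) xy(1,2) bspec[OF xy(3)]] .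
  moreover have "x \<in> E \<longleftrightarrow> y \<in> E" using saturatedD[OF assms(2) xy(1,2) bspec[OF xy(3)]] .
  ultimately show "x \<in> D \<inter> E \<longleftrightarrow> y \<in> D \<inter> E" by simp
qed

text \<open>
  The condition on \<open>A - E\<close> says that every time is decided, by a step inside \<open>E\<close> or by one outside.
  Together the conditions pass to complements and intersections and hold for the members of the
  chain, so no atoms have to be listed to see that they hold for all sets generated from it.
\<close>

definition step_sets :: "'a set set" where
  "step_sets = {E \<in> M. levels E \<in> sets borel \<and> levels (A - E) = {0..<v A} - levels E \<and>
                  (\<exists>T. finite T \<and> T \<subseteq> C \<and> saturated T E)}"

lemma step_sets_M: "step_sets \<subseteq> M"
  by (auto simp: step_sets_def)

lemma chain_step_sets: "C \<subseteq> step_sets"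
proof
  fix J assume J: "J \<in> C"
  have "levels (A - J) = {0..<v A} - levels J"
  proof
    have "levels (A - J) \<inter> levels J = {}"
      by (rule levels_disjoint) blast
    moreover have "levels (A - J) \<subseteq> {0..<v A}" by (rule levels_subset) auto
    ultimately show "levels (A - J) \<subseteq> {0..<v A} - levels J" by blast
    show "{0..<v A} - levels J \<subseteq> levels (A - J)"
      using J space_in_chain by (auto simp: levels_chain intro: levelsI)
  qed
  moreover have "saturated {J} J" by (auto simp: saturated_def)
  ultimately show "J \<in> step_sets"
    using J chain_sets[OF J] unfolding step_sets_def
    by (auto simp: levels_chain intro!: exI[of _ "{J}"])
qed

lemma algebra_step_sets: "algebra A step_sets"
  unfolding algebra_iff_Int
proof (intro conjI ballI)
  show "step_sets \<subseteq> Pow A" using step_sets_M space_closed by blast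
  show "{} \<in> step_sets" using chain_step_sets empty_in_chain by blast
next
  fix E assume E: "E \<in> step_sets"
  then have "E \<subseteq> A" using step_sets_M sets_into_space by blast
  then have dd: "A - (A - E) = E" by blast
  obtain T where T: "finite T" "T \<subseteq> C" "saturated T E" using E unfolding step_sets_def by blast
  have "saturated T (A - E)"
    using T(3) unfolding saturated_def by blast
  moreover have "levels (A - E) \<in> sets borel" "A - E \<in> M"
    using E by (auto simp: step_sets_def)
  moreover have "levels E \<subseteq> {0..<v A}" using levels_subset \<open>E \<subseteq> A\<close> by blast
  then have "levels (A - (A - E)) = {0..<v A} - levels (A - E)"
    using E unfolding dd step_sets_def by blast
  ultimately show "A - E \<in> step_sets"
    using T(1,2) unfolding step_sets_def by blast
next
  fix D E assume D: "D \<in> step_sets" and E: "E \<in> step_sets"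
  obtain S where S: "finite S" "S \<subseteq> C" "saturated S D" using D unfolding step_sets_def by blast
  obtain T where T: "finite T" "T \<subseteq> C" "saturated T E" using E unfolding step_sets_def by blast
  have sat: "saturated (S \<union> T) (D \<inter> E)"
    using S(3) T(3) by (intro saturated_Int) (auto intro: saturated_mono)
  have "levels (A - D \<inter> E) = {0..<v A} - levels (D \<inter> E)"
  proof
    have "levels (A - D \<inter> E) \<inter> levels (D \<inter> E) = {}"
      by (rule levels_disjoint) blast
    moreover have "levels (A - D \<inter> E) \<subseteq> {0..<v A}" by (rule levels_subset) auto
    ultimately show "levels (A - D \<inter> E) \<subseteq> {0..<v A} - levels (D \<inter> E)" by blast
    have "{0..<v A} - levels (D \<inter> E) = levels (A - D) \<union> levels (A - E)"
      using D E by (auto simp: step_sets_def levels_Int)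
    also have "\<dots> \<subseteq> levels (A - D \<inter> E)"
      using levels_mono[of "A - D" "A - D \<inter> E"] levels_mono[of "A - E" "A - D \<inter> E"] by blast
    finally show "{0..<v A} - levels (D \<inter> E) \<subseteq> levels (A - D \<inter> E)" .
  qed
  moreover have "levels (D \<inter> E) \<in> sets borel" "D \<inter> E \<in> M"
    using D E by (auto simp: step_sets_def levels_Int)
  ultimately show "D \<inter> E \<in> step_sets"
    unfolding step_sets_def using S(1,2) T(1,2) sat
    by (intro CollectI conjI exI[of _ "S \<union> T"]) auto
qed

text \<open>
  A time of \<open>D \<union> E\<close> that is not a time of \<open>D\<close> is decided for \<open>A - D\<close>, hence it is a time of
  \<open>(D \<union> E) \<inter> (A - D) \<subseteq> E\<close>.
\<close>

lemma levels_Un: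
  assumes "D \<in> step_sets" "E \<in> step_sets"
  shows "levels (D \<union> E) = levels D \<union> levels E"
proof
  interpret S: algebra A step_sets by (rule algebra_step_sets)
  have sub: "D \<subseteq> A" "E \<subseteq> A" using assms S.sets_into_space by blast+
  have "levels (D \<union> E) \<inter> levels (A - D) \<subseteq> levels E"
    unfolding levels_Int[symmetric] by (rule levels_mono) blast
  moreover have "levels (D \<union> E) \<subseteq> {0..<v A}" using sub by (intro levels_subset) auto
  ultimately show "levels (D \<union> E) \<subseteq> levels D \<union> levels E"
    using assms by (auto simp: step_sets_def)
  show "levels D \<union> levels E \<subseteq> levels (D \<union> E)"
    by (simp add: levels_mono)
qed

lemma levels_fmeasurable:
  assumes "E \<in> step_sets"
  shows "levels E \<in> fmeasurable lborel"
proof (rule fmeasurableI2)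
  show "{0..<v A} \<in> fmeasurable lborel" by (cases "0 \<le> v A") (auto simp: fmeasurable_def)
  show "levels E \<subseteq> {0..<v A}" using assms step_sets_M sets_into_space levels_subset by blast
  show "levels E \<in> sets lborel" using assms by (simp add: step_sets_def)
qed

text \<open>
  Follow the finitely many members of \<open>T\<close> upwards and compare the two sides on \<open>E \<inter> J\<close>. The set
  between a member \<open>I\<close> and the next one \<open>J\<close> is an atom, so it lies inside or outside \<open>E\<close>. Inside,
  submodularity for \<open>E \<inter> J\<close> and \<open>I\<close>, whose union is \<open>J\<close> and whose intersection is \<open>E \<inter> I\<close>,
  gives \<open>v J - v I \<le> v (E \<inter> J) - v (E \<inter> I)\<close>.
\<close>

lemma measure_levels_le:
  assumes "E \<in> step_sets"
  shows "measure lborel (levels E) \<le> v E"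
proof -
  obtain T0 where T0: "finite T0" "T0 \<subseteq> C" "saturated T0 E"
    using assms unfolding step_sets_def by blast
  \<comment> \<open>With \<open>{}\<close> in \<open>T\<close>, every nonempty \<open>J\<close> has a predecessor, and the induction ends at \<open>{}\<close>.\<close>
  define T where "T = insert {} T0"
  have T: "finite T" "T \<subseteq> C" "{} \<in> T"
    using T0(1,2) empty_in_chain unfolding T_def by auto
  have "saturated T E"
    using T0(3) by (rule saturated_mono) (auto simp: T_def)
  note T = T this
  have EM: "E \<in> M" using assms step_sets_M by blast
  have fm: "levels E \<inter> {..<t} \<in> fmeasurable lborel" for t
    using levels_fmeasurable[OF assms] by (rule fmeasurable_Int_fmeasurable) simp
  have main: "measure lborel (levels E \<inter> {..<v J}) \<le> v (E \<inter> J)" if "J \<in> C" for J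
    using that
  proof (induction "card {I\<in>T. I \<subset> J}" arbitrary: J rule: less_induct)
    case less
    note J = \<open>J \<in> C\<close>
    show ?case
    proof (cases "J = {}")
      case True
      have "levels E \<inter> {..<0} = {}"
        using levels_subset[OF sets_into_space[OF EM]] by fastforce
      then show ?thesis using True by (simp add: v_empty)
    next
      case False
      let ?S = "{I\<in>T. I \<subset> J}"
      have "finite ?S" "?S \<noteq> {}" using T False by auto
      then obtain I where "I \<in> ?S" and max: "\<And>K. K \<in> ?S \<Longrightarrow> I \<subseteq> K \<Longrightarrow> I = K"
        using finite_has_maximal[of ?S] by metis
      then have I: "I \<in> T" "I \<in> C" "I \<subset> J" using T by auto
      have greatest: "K \<subseteq> I \<or> J \<subseteq> K" if "K \<in> T" for K
        using chain[of K I] chain[of K J] max[of K] that T(2) I J by blast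
      have JA: "J \<subseteq> A" using J chain_sets sets_into_space by blast
      have "card {K\<in>T. K \<subset> I} < card ?S"
        using T I by (intro psubset_card_mono) auto
      then have IH: "measure lborel (levels E \<inter> {..<v I}) \<le> v (E \<inter> I)"
        using less.hyps I by blast
      have "x \<in> E \<longleftrightarrow> y \<in> E" if "x \<in> J - I" "y \<in> J - I" for x y
      proof -
        have "\<forall>K\<in>T. x \<in> K \<longleftrightarrow> y \<in> K" using greatest that by blast
        moreover have "x \<in> A" "y \<in> A" using that JA by blast+
        ultimately show ?thesis using saturatedD[OF T(4)] by blast
      qed
      then consider "J - I \<subseteq> E" | "(J - I) \<inter> E = {}" by blast
      then show ?thesis
      proof cases
        case 1
        have le: "v I \<le> v J" using v_mono chain_sets I J by blast
        have "measure lborel (levels E \<inter> {..<v J})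
              \<le> measure lborel ((levels E \<inter> {..<v I}) \<union> {v I..<v J})"
        proof (rule measure_mono_fmeasurable)
          show "levels E \<inter> {..<v J} \<in> sets lborel" using fm by blast
          show "levels E \<inter> {..<v I} \<union> {v I..<v J} \<in> fmeasurable lborel"
            using fm le by (intro fmeasurable.Un) (auto simp: fmeasurable_def)
        qed auto
        also have "\<dots> \<le> measure lborel (levels E \<inter> {..<v I}) + measure lborel {v I..<v J}"
          by (intro measure_Un_le fmeasurableD[OF fm]) simp
        also have "\<dots> \<le> v (E \<inter> I) + (v J - v I)"
          using IH le by simp
        also have "\<dots> \<le> v (E \<inter> J)"
        proof -
          have "E \<inter> J \<union> I = J" "E \<inter> J \<inter> I = E \<inter> I" using 1 I by auto
          then show ?thesis
            using v_submod[of "E \<inter> J" I] Int[OF EM chain_sets[OF J]] chain_sets[OF I(2)]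
            by simp
        qed
        finally show ?thesis .
      next
        case 2
        have "r < v I" if "r \<in> levels E" "r < v J" for r
        proof (rule ccontr)
          assume "\<not> r < v I"
          then have "r \<in> levels (J - I)" using I J that by (auto intro: levelsI)
          then have "r \<in> levels ((J - I) \<inter> E)" using that by (simp add: levels_Int)
          then show False using 2 by (simp add: levels_empty)
        qed
        moreover have "v I \<le> v J" using v_mono chain_sets I J by blast
        ultimately have "levels E \<inter> {..<v J} = levels E \<inter> {..<v I}" by fastforce
        moreover have "E \<inter> J = E \<inter> I" using 2 I by blast
        ultimately show ?thesis using IH by simp
      qed
    qed
  qed
  have "levels E \<inter> {..<v A} = levels E"
    using levels_subset[OF sets_into_space[OF EM]] by auto
  moreover have "E \<inter> A = E" using sets_into_space[OF EM] by blast
  ultimately show ?thesis using main[OF space_in_chain] by simp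
qed

subsection \<open>The measure determined by the chain\<close>

text \<open>
  The domination by \<open>v\<close> is used twice: on the algebra it yields continuity at \<open>{}\<close> and thereby
  the extension, and then it is transported to the whole \<open>\<sigma>\<close>-algebra.
\<close>

lemma exists_dominated_measure:
  obtains \<mu> where "space \<mu> = A" "sets \<mu> = M" "finite_measure \<mu>"
    "\<And>J. J \<in> C \<Longrightarrow> measure \<mu> J = v J" "\<And>E. E \<in> M \<Longrightarrow> measure \<mu> E \<le> v E"
proof -
  interpret S: algebra A step_sets by (rule algebra_step_sets)
  define f where "f E = emeasure lborel (levels E)" for E
  have f_eq: "f E = ennreal (measure lborel (levels E))" if "E \<in> step_sets" for E
    unfolding f_def
    by (intro emeasure_eq_ennreal_measure fmeasurableD2[OF levels_fmeasurable[OF that]])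
  have f_le: "f E \<le> ennreal (v E)" if "E \<in> step_sets" for E
    using measure_levels_le[OF that] f_eq[OF that] by (simp add: ennreal_leI)
  have "\<exists>m :: 'a set \<Rightarrow> ennreal. (\<forall>s\<in>step_sets. m s = f s) \<and>
      measure_space A (sigma_sets A step_sets) m"
  proof (rule S.caratheodory_empty_continuous)
    show "positive step_sets f"
      by (simp add: positive_def f_def levels_empty)
    show "additive step_sets f"
      unfolding additive_def
    proof (intro ballI impI)
      fix D E assume D: "D \<in> step_sets" and E: "E \<in> step_sets" and "D \<inter> E = {}"
      then have "levels D \<inter> levels E = {}" by (intro levels_disjoint)
      then show "f (D \<union> E) = f D + f E"
        unfolding f_def levels_Un[OF D E]
        using D E by (intro plus_emeasure[symmetric]) (auto simp: step_sets_def)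
    qed
    show "f E \<noteq> \<infinity>" if "E \<in> step_sets" for E
      using f_eq[OF that] by simp
    fix X :: "nat \<Rightarrow> 'a set"
    assume X: "range X \<subseteq> step_sets" "decseq X" "(\<Inter>i. X i) = {}"
    have "(\<lambda>i. v (X i)) \<longlonglongrightarrow> 0"
      using v_down[of X] X(2) order_trans[OF X(1) step_sets_M] by (simp add: X(3) v_empty)
    then have "(\<lambda>i. ennreal (v (X i))) \<longlonglongrightarrow> 0"
      using tendsto_ennrealI[of "\<lambda>i. v (X i)" 0] by simp
    moreover have "f (X i) \<le> ennreal (v (X i))" for i
      using f_le X(1) by blast
    ultimately show "(\<lambda>i. f (X i)) \<longlonglongrightarrow> 0"
      by (intro tendsto_sandwich[where f = "\<lambda>_. 0" and g = "\<lambda>i. f (X i)"]) simp_all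
  qed
  then obtain m where m: "\<And>E. E \<in> step_sets \<Longrightarrow> m E = f E"
    and ms: "measure_space A (sigma_sets A step_sets) m" by blast
  have sig: "sigma_sets A step_sets = M"
  proof
    show "sigma_sets A step_sets \<subseteq> M" using step_sets_M by (rule sigma_sets_subset)
    show "M \<subseteq> sigma_sets A step_sets"
      using sigma_sets_subseteq[OF chain_step_sets, of A] by (simp add: generates)
  qed
  define \<mu> where "\<mu> = measure_of A M m"
  have space: "space \<mu> = A" and sets: "sets \<mu> = M"
    using space_closed by (auto simp: \<mu>_def space_measure_of_conv sigma_sets_eq)
  have em: "emeasure \<mu> E = m E" if "E \<in> M" for E
    using ms that unfolding \<mu>_def sig measure_space_def
    by (intro emeasure_measure_of_sigma) auto
  have step: "emeasure \<mu> E = ennreal (measure lborel (levels E))" if "E \<in> step_sets" for E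
    using em[OF subsetD[OF step_sets_M that]] m[OF that] f_eq[OF that] by simp
  have fin: "finite_measure \<mu>"
  proof
    show "emeasure \<mu> (space \<mu>) \<noteq> \<infinity>"
      unfolding space step[OF subsetD[OF chain_step_sets space_in_chain]] by simp
  qed
  interpret N: finite_measure \<mu> by (rule fin)
  have meas: "measure \<mu> E = measure lborel (levels E)" if "E \<in> step_sets" for E
    unfolding measure_def[of \<mu>] by (simp add: step[OF that])
  show thesis
  proof (rule that[OF space sets fin])
    show "measure \<mu> J = v J" if "J \<in> C" for J
      using meas[OF subsetD[OF chain_step_sets that]] v_nonneg[OF chain_sets[OF that]]
      by (simp add: levels_chain[OF that])
    fix E assume "E \<in> M"
    then have "E \<in> monotone_class step_sets"
      using S.monotone_class_eq_sigma_sets sig by simp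
    then show "measure \<mu> E \<le> v E"
    proof induction
      case (base E)
      then show ?case using meas measure_levels_le by simp
    next
      case (up X)
      then have X: "range X \<subseteq> M" by (auto simp: S.monotone_class_eq_sigma_sets sig)
      have "(\<lambda>n. measure \<mu> (X n)) \<longlonglongrightarrow> measure \<mu> (\<Union>n. X n)"
        using X up.hyps unfolding sets[symmetric] by (intro N.finite_Lim_measure_incseq)
      then show ?case
        by (rule LIMSEQ_le[OF _ v_up[OF X up.hyps(2)]]) (use up.IH in blast)
    next
      case (down X)
      then have X: "range X \<subseteq> M" by (auto simp: S.monotone_class_eq_sigma_sets sig)
      have "(\<lambda>n. measure \<mu> (X n)) \<longlonglongrightarrow> measure \<mu> (\<Inter>n. X n)"
        using X down.hyps unfolding sets[symmetric] by (intro N.finite_Lim_measure_decseq)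
      then show ?case
        by (rule LIMSEQ_le[OF _ v_down[OF X down.hyps(2)]]) (use down.IH in blast)
    qed
  qed
qed

lemma measure_eqI_chain:
  assumes "sets \<mu> = M" "finite_measure \<mu>" "sets \<nu> = M" "finite_measure \<nu>"
    and "\<And>J. J \<in> C \<Longrightarrow> measure \<mu> J = measure \<nu> J"
  shows "\<mu> = \<nu>"
proof (rule measure_eqI_generator_eq[where E = C and A = "\<lambda>_. A" and \<Omega> = A])
  show "Int_stable C" by (auto simp: Int_stable_def chain_Int)
  show "C \<subseteq> Pow A" using chain_sets sets_into_space by blast
  show "emeasure \<mu> J = emeasure \<nu> J" if "J \<in> C" for J
    using assms that by (simp add: finite_measure.emeasure_eq_measure)
  show "emeasure \<mu> A \<noteq> \<infinity>"
    using finite_measure.emeasure_finite[OF assms(2)] by simp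
qed (use assms generates space_in_chain in auto)

end

section \<open>The refined chain\<close>

lemma sigma_sets_refined_class:
  assumes F: "sigma_algebra \<Omega> F" "\<I> \<subseteq> F" "sigma_sets \<Omega> \<I> = F" "{} \<in> \<I>"
    and A: "A \<in> F" and B: "B \<in> F" "B \<subseteq> A"
  shows "sigma_sets A (refined_class \<I> A B) = sub_sigma F A"
proof -
  interpret F: sigma_algebra \<Omega> F by fact
  let ?C = "refined_class \<I> A B"
  have trace: "trace_class \<I> A = (\<inter>) A ` \<I>" by (auto simp: trace_class_def)
  have "sub_sigma F A = (\<inter>) A ` F"
    using A by (auto simp: sub_sigma_def)
  also have "\<dots> = sigma_sets A (trace_class \<I> A)"
    using sigma_sets_Int[of A \<Omega> \<I>] A F F.sets_into_space[OF A] trace by simp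
  finally have sub: "sub_sigma F A = sigma_sets A (trace_class \<I> A)" .
  have C: "?C \<subseteq> sub_sigma F A"
    using A B F(2) by (auto simp: refined_class_def trace_class_def sub_sigma_def)
  then have CA: "?C \<subseteq> Pow A" by (auto simp: sub_sigma_def)
  interpret C: sigma_algebra A "sigma_sets A ?C" by (rule sigma_algebra_sigma_sets[OF CA])
  have BC: "B \<in> ?C"
    using F(4) unfolding refined_class_def trace_class_def by (blast intro: Un_empty_right)
  have "trace_class \<I> A \<subseteq> sigma_sets A ?C"
  proof
    fix J assume J: "J \<in> trace_class \<I> A"
    have "J = (B \<inter> J) \<union> ((B \<union> J) - B)" by blast
    moreover have "B \<inter> J \<in> sigma_sets A ?C" "B \<union> J \<in> sigma_sets A ?C" "B \<in> sigma_sets A ?C"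
      using J BC by (auto simp: refined_class_def intro!: sigma_sets.Basic)
    ultimately show "J \<in> sigma_sets A ?C" by (metis C.Diff C.Un)
  qed
  then have "sigma_sets A (trace_class \<I> A) \<subseteq> sigma_sets A ?C"
    by (rule C.sigma_sets_subset)
  moreover have "sigma_sets A ?C \<subseteq> sigma_sets A (trace_class \<I> A)"
    using C unfolding sub by (rule sigma_sets_mono)
  ultimately show ?thesis using sub by simp
qed

lemma submodular_chain_refined_class:
  assumes F: "sigma_algebra \<Omega> F" "\<I> \<subseteq> F" "sigma_sets \<Omega> \<I> = F" "{} \<in> \<I>" "\<Omega> \<in> \<I>"
    and chain: "\<forall>I1\<in>\<I>. \<forall>I2\<in>\<I>. I1 \<subseteq> I2 \<or> I2 \<subseteq> I1"
    and v: "submodular F v"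
    and A: "A \<in> F" and B: "B \<in> F" "B \<subseteq> A"
  shows "submodular_chain A (sub_sigma F A) (refined_class \<I> A B) v"
proof -
  interpret F: sigma_algebra \<Omega> F by fact
  let ?C = "refined_class \<I> A B"
  have gen: "sigma_sets A ?C = sub_sigma F A"
    using sigma_sets_refined_class[OF F(1-4) A B] .
  have "?C \<subseteq> Pow A" using B by (auto simp: refined_class_def trace_class_def)
  then have "sigma_algebra A (sub_sigma F A)"
    using sigma_algebra_sigma_sets gen by metis
  moreover have "submodular_chain_axioms A (sub_sigma F A) ?C v"
  proof
    show "submodular (sub_sigma F A) v"
      using v by (rule submodular_subset) (auto simp: sub_sigma_def)
    show "sigma_sets A ?C = sub_sigma F A" by (rule gen)
    show "{} \<in> ?C"
      using F(4) unfolding refined_class_def trace_class_def by blast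
    have "A = B \<union> (\<Omega> \<inter> A)" using B F.sets_into_space[OF A] by blast
    then show "A \<in> ?C"
      using F(5) unfolding refined_class_def trace_class_def by blast
    have tr: "J \<subseteq> K \<or> K \<subseteq> J" if "J \<in> trace_class \<I> A" "K \<in> trace_class \<I> A" for J K
      using that chain unfolding trace_class_def by blast
    show "J \<subseteq> K \<or> K \<subseteq> J" if J: "J \<in> ?C" and K: "K \<in> ?C" for J K
    proof -
      obtain J' where J': "J' \<in> trace_class \<I> A" "J = B \<inter> J' \<or> J = B \<union> J'"
        using J unfolding refined_class_def by blast
      obtain K' where K': "K' \<in> trace_class \<I> A" "K = B \<inter> K' \<or> K = B \<union> K'"
        using K unfolding refined_class_def by blast
      show ?thesis using tr[OF J'(1) K'(1)] J'(2) K'(2) by blast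
    qed
  qed
  ultimately show ?thesis by (simp add: submodular_chain_def)
qed

theorem theorem4:
  fixes \<Omega> :: "'a set" and F \<I> :: "'a set set" and v :: "'a set \<Rightarrow> real"
  assumes "sigma_algebra \<Omega> F"
    and "\<I> \<subseteq> F"
    and "sigma_sets \<Omega> \<I> = F"
    and "{} \<in> \<I>"
    and "\<Omega> \<in> \<I>"
    and "\<forall>I1\<in>\<I>. \<forall>I2\<in>\<I>. I1 \<subseteq> I2 \<or> I2 \<subseteq> I1"
    and "submodular F v"
  shows "(\<forall>A\<in>F. \<forall>B\<in>F. B \<subseteq> A \<longrightarrow>
            (\<exists>!\<mu>. \<mu> \<in> core_minus F v A \<and> (\<forall>J \<in> refined_class \<I> A B. v J = measure \<mu> J)) \<and>
            (\<forall>\<mu>. \<mu> \<in> core_minus F v A \<and> (\<forall>J \<in> refined_class \<I> A B. v J = measure \<mu> J)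
                 \<longrightarrow> v B = measure \<mu> B)) \<and>
         (\<forall>A\<in>F. \<forall>B\<in>F. B \<subseteq> A \<longrightarrow> v B = (SUP \<mu> \<in> core_minus F v A. measure \<mu> B))"
proof -
  have unique: "\<exists>!\<mu>. \<mu> \<in> core_minus F v A \<and> (\<forall>J \<in> refined_class \<I> A B. v J = measure \<mu> J)"
    if A: "A \<in> F" and B: "B \<in> F" "B \<subseteq> A" for A B
  proof -
    interpret submodular_chain A "sub_sigma F A" "refined_class \<I> A B" v
      using submodular_chain_refined_class[OF assms A B] .
    obtain \<mu> where \<mu>: "space \<mu> = A" "sets \<mu> = sub_sigma F A" "finite_measure \<mu>"
      "\<And>J. J \<in> refined_class \<I> A B \<Longrightarrow> measure \<mu> J = v J"
      "\<And>E. E \<in> sub_sigma F A \<Longrightarrow> measure \<mu> E \<le> v E"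
      by (rule exists_dominated_measure, rule that)
    show ?thesis
    proof (rule ex1I[of _ \<mu>])
      show "\<mu> \<in> core_minus F v A \<and> (\<forall>J \<in> refined_class \<I> A B. v J = measure \<mu> J)"
        using \<mu> space_in_chain by (auto simp: core_minus_def finite_measures_on_def)
      fix \<nu> assume "\<nu> \<in> core_minus F v A \<and> (\<forall>J \<in> refined_class \<I> A B. v J = measure \<nu> J)"
      then show "\<nu> = \<mu>"
        using \<mu> by (intro measure_eqI_chain) (auto simp: core_minus_def finite_measures_on_def)
    qed
  qed
  have mem: "B \<in> refined_class \<I> A B" for A B
    using assms(4) unfolding refined_class_def trace_class_def by (blast intro: Un_empty_right)
  have sup: "v B = (SUP \<mu> \<in> core_minus F v A. measure \<mu> B)"
    if A: "A \<in> F" and B: "B \<in> F" "B \<subseteq> A" for A B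
  proof -
    obtain \<mu> where "\<mu> \<in> core_minus F v A" "v B = measure \<mu> B"
      using unique[OF A B] mem by blast
    moreover have "measure \<nu> B \<le> v B" if "\<nu> \<in> core_minus F v A" for \<nu>
      using that B by (auto simp: core_minus_def sub_sigma_def)
    ultimately show ?thesis
      by (intro cSup_eq_maximum[symmetric]) auto
  qed
  show ?thesis using unique mem sup by blast
qed

end
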